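(* Let $r\ge 0$ be an integer and let $a,b$ be indeterminates. For all integers $n,m\ge 0$, $$\mathcal{G}_{a,b}(n+m;r)=\sum_{i=0}^n\sum_{j=0}^m \binom{n}{i}\,\mathcal{G}_{a,b}(m,j;r)\,\mathcal{G}_{a,b}(i;0)\prod_{\ell=0}^{n-i-1}\bigl(a\ell+a(m+r)+b(j+r)\bigr).$$
   Context: Write $[m]=\{1,\ldots,m\}$, $[0]=\varnothing$. A Lah distribution of $[m]$ into $\ell$ blocks is a partition of $[m]$ into $\ell$ non-empty, pairwise disjoint blocks in which the elements within each block are linearly ordered (the blocks themselves are not ordered). For integers $n,k,r$ with $0\le k\le n$ and $r\ge 0$, let $\mathcal{L}_r(n,k)$ be the set of Lah distributions of $[n+r]$ into $k+r$ blocks in which the elements of $[r]$ belong to distinct blocks. An element $i$ of a Lah distribution $\lambda$ is a record low if there is no element $j<i$ to the left of $i$ within its block. Let $rec^*(\lambda)$ be the number of record lows of $\lambda$ that are not the smallest element of their block, and let $nrec(\lambda)$ be the number of elements of the underlying set that are not record lows of $\lambda$. The generalized $r$-Lah number is the polynomial in indeterminates $a,b$ $$\mathcal{G}_{a,b}(n,k;r)=\sum_{\lambda\in\mathcal{L}_r(n,k)}a^{nrec(\lambda)}b^{rec^*(\lambda)},$$ with $\mathcal{G}_{a,b}(n,k;r)=0$ unless $0\le k\le n$ and $r\ge 0$. The row sums are $\mathcal{G}_{a,b}(n;r)=\sum_{k=0}^n\mathcal{G}_{a,b}(n,k;r)$ for $n\ge 0$. Empty sums are $0$ and empty products are $1$.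 *)

theory Defs
  imports Main "HOL-Library.Disjoint_Sets"
begin

text \<open>
  A block with a linear order on its elements is a nonempty list without repetitions.
  The condition \<open>inj_on set L\<close> says that no two members of \<open>L\<close> are orderings of the same
  block, so \<open>card L\<close> is the number of blocks.
\<close>

definition lah_distribution :: "nat \<Rightarrow> nat \<Rightarrow> nat list set \<Rightarrow> bool" where
  "lah_distribution m l L \<longleftrightarrow>
     partition_on {1..m} (set ` L) \<and> inj_on set L \<and> (\<forall>B\<in>L. distinct B) \<and> card L = l"

definition r_lah_distributions :: "nat \<Rightarrow> nat \<Rightarrow> nat \<Rightarrow> nat list set set" where
  "r_lah_distributions r n k =
     {L. lah_distribution (n + r) (k + r) L \<and>
         (\<forall>B\<in>L. \<forall>i\<in>{1..r}. \<forall>j\<in>{1..r}. i \<in> set B \<and> j \<in> set B \<longrightarrow> i = j)}"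

definition block_record_lows :: "nat list \<Rightarrow> nat set" where
  "block_record_lows B = {B ! p |p. p < length B \<and> (\<forall>q<p. \<not> B ! q < B ! p)}"

definition rec_star :: "nat list set \<Rightarrow> nat" where
  "rec_star L = card {i. \<exists>B\<in>L. i \<in> block_record_lows B \<and> i \<noteq> Min (set B)}"

definition nrec :: "nat list set \<Rightarrow> nat" where
  "nrec L = card ((\<Union>B\<in>L. set B) - (\<Union>B\<in>L. block_record_lows B))"

text \<open>
  The parameters \<open>a\<close> and \<open>b\<close> range over an arbitrary commutative semiring; for the polynomial
  itself, take the two generators of a polynomial ring such as \<open>int poly poly\<close>.
\<close>

definition gen_r_lah :: "'a::comm_semiring_1 \<Rightarrow> 'a \<Rightarrow> nat \<Rightarrow> nat \<Rightarrow> nat \<Rightarrow> 'a" where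
  "gen_r_lah a b n k r =
     (if k \<le> n then \<Sum>L\<in>r_lah_distributions r n k. a ^ nrec L * b ^ rec_star L else 0)"

definition gen_r_lah_row :: "'a::comm_semiring_1 \<Rightarrow> 'a \<Rightarrow> nat \<Rightarrow> nat \<Rightarrow> 'a" where
  "gen_r_lah_row a b n r = (\<Sum>k=0..n. gen_r_lah a b n k r)"

text \<open>A sum over an infinite set would be \<open>0\<close>; the index set above is finite.\<close>

lemma finite_r_lah_distributions: "finite (r_lah_distributions r n k)"
proof (rule finite_subset)
  let ?X = "{B. set B \<subseteq> {1..n + r} \<and> length B \<le> n + r}"
  have "B \<in> ?X" if "lah_distribution (n + r) (k + r) L" "B \<in> L" for L B
  proof -
    have sub: "set B \<subseteq> {1..n + r}" and "distinct B"
      using that by (auto simp: lah_distribution_def partition_on_def)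
    moreover have "card (set B) \<le> n + r"
      using card_mono[OF _ sub] by simp
    ultimately show ?thesis
      by (simp add: distinct_card)
  qed
  then show "r_lah_distributions r n k \<subseteq> Pow ?X"
    unfolding r_lah_distributions_def by blast
  show "finite (Pow ?X)"
    by (simp add: finite_lists_length_le)
qed

end

theory Submission
  imports Defs
begin

text \<open>
  Inserting a new largest element into a Lah distribution with \<open>N\<close> elements and \<open>K\<close> blocks
  multiplies the weight by \<open>1\<close> (new block), by \<open>b\<close> (front of one of the \<open>K\<close> blocks) or by \<open>a\<close>
  (directly after one of the \<open>N\<close> elements). So the total weight \<open>E n x\<close> of all ways to insert \<open>n\<close>
  further elements depends only on \<open>x = a * N + b * K\<close>, and it satisfies
  \<open>E (n + 1) x = E n (x + a + b) + x * E n (x + a)\<close>. From this recurrence,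
  \<open>E n (x + y) = (\<Sum>i\<le>n. (n choose i) * E i x * (\<Prod>l<n - i. a * l + y))\<close> follows by induction
  on \<open>n\<close>; the theorem is the case \<open>x = 0\<close>, summed over the distributions of the first \<open>m + r\<close>
  elements.
\<close>

section \<open>The weight of a block\<close>

lemma block_record_lows_Nil [simp]: "block_record_lows [] = {}"
  by (simp add: block_record_lows_def)

text \<open>Whether an entry is a record low depends only on the entries before it, so appending
  never changes the status of earlier entries.\<close>

lemma block_record_lows_snoc:
  "block_record_lows (xs @ [x]) =
     block_record_lows xs \<union> (if \<forall>y\<in>set xs. \<not> y < x then {x} else {})"
proof -
  have "block_record_lows (xs @ [x]) =
      {(xs @ [x]) ! p |p. p < length xs \<and> (\<forall>q<p. \<not> (xs @ [x]) ! q < (xs @ [x]) ! p)} \<union>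
      {(xs @ [x]) ! p |p. p = length xs \<and> (\<forall>q<p. \<not> (xs @ [x]) ! q < (xs @ [x]) ! p)}"
    unfolding block_record_lows_def length_append_singleton less_Suc_eq by blast
  also have "{(xs @ [x]) ! p |p. p < length xs \<and> (\<forall>q<p. \<not> (xs @ [x]) ! q < (xs @ [x]) ! p)} =
      block_record_lows xs"
    unfolding block_record_lows_def by (auto simp: nth_append)
  also have "{(xs @ [x]) ! p |p. p = length xs \<and> (\<forall>q<p. \<not> (xs @ [x]) ! q < (xs @ [x]) ! p)} =
      (if \<forall>y\<in>set xs. \<not> y < x then {x} else {})"
    by (auto simp: nth_append all_set_conv_all_nth)
  finally show ?thesis .
qed

lemma block_record_lows_subset: "block_record_lows B \<subseteq> set B"
  by (auto simp: block_record_lows_def)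

lemma finite_block_record_lows [simp]: "finite (block_record_lows B)"
  by (rule finite_subset[OF block_record_lows_subset]) simp

text \<open>Nothing is smaller than the minimum. Hence a non-empty block has at least one record
  low, and discounting its minimum lowers the count by exactly one.\<close>

lemma Min_mem_block_record_lows:
  assumes "B \<noteq> []"
  shows "Min (set B) \<in> block_record_lows B"
proof -
  obtain us vs where B: "B = us @ Min (set B) # vs"
    using assms by (meson List.finite_set Min_in set_empty split_list)
  then have "Min (set B) = B ! length us" "length us < length B"
    by (metis nth_append_length, metis length_append length_Cons less_add_Suc1 add_Suc_right)
  moreover have "\<not> B ! q < Min (set B)" if "q < length us" for q
    using that \<open>length us < length B\<close> by (simp add: leD)
  ultimately show ?thesis
    unfolding block_record_lows_def by (smt (verit) mem_Collect_eq)
qed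

text \<open>The maximum \<open>N\<close> never precedes a larger entry, so it spoils no record low;
  it is one itself only if nothing stands before it. The induction extends the part behind
  \<open>N\<close> at its right end.\<close>

lemma block_record_lows_insert_max:
  assumes "\<forall>x\<in>set (us @ vs). x < N"
  shows "block_record_lows (us @ N # vs) =
    (if us = [] then insert N (block_record_lows vs) else block_record_lows (us @ vs))"
  using assms
proof (induction vs rule: rev_induct)
  case Nil
  show ?case
    using Nil block_record_lows_snoc[of us N] by (cases "us = []") (auto dest: last_in_set)
next
  case (snoc x vs)
  then have IH: "block_record_lows (us @ N # vs) =
      (if us = [] then insert N (block_record_lows vs) else block_record_lows (us @ vs))"
    by simp
  have "block_record_lows (us @ N # vs @ [x]) = block_record_lows ((us @ N # vs) @ [x])"
    by simp
  also have "\<dots> = block_record_lows (us @ N # vs) \<union>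
      (if \<forall>y\<in>set (us @ vs). \<not> y < x then {x} else {})"
    unfolding block_record_lows_snoc using snoc.prems by auto
  finally show ?case
    unfolding IH using block_record_lows_snoc[of vs x] block_record_lows_snoc[of "us @ vs" x]
    by auto
qed

text \<open>The share of one block in the weight of a distribution. The \<open>- 1\<close> discounts
  the minimum of the block, which \<open>rec_star\<close> does not count.\<close>

definition block_weight :: "'a::comm_semiring_1 \<Rightarrow> 'a \<Rightarrow> nat list \<Rightarrow> 'a" where
  "block_weight a b B =
     a ^ (card (set B) - card (block_record_lows B)) * b ^ (card (block_record_lows B) - 1)"

lemma block_weight_singleton [simp]: "block_weight a b [x] = 1"
  using block_record_lows_snoc[of "[]" x] by (simp add: block_weight_def)

text \<open>At the front, \<open>N\<close> is a record low but not the minimum, since the block was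
  non-empty; anywhere else it is not a record low.\<close>

lemma block_weight_insert_max:
  assumes "\<forall>x\<in>set (us @ vs). x < N" and "us @ vs \<noteq> []"
  shows "block_weight a b (us @ N # vs) = (if us = [] then b else a) * block_weight a b (us @ vs)"
proof -
  have le: "card (block_record_lows (us @ vs)) \<le> card (set (us @ vs))"
    by (rule card_mono[OF _ block_record_lows_subset]) simp
  have notin: "N \<notin> set (us @ vs)"
    using assms(1) by blast
  then have c: "card (set (us @ N # vs)) = Suc (card (set (us @ vs)))"
    by simp
  have "0 < card (block_record_lows (us @ vs))"
    using Min_mem_block_record_lows[OF assms(2)] by (auto simp: card_gt_0_iff)
  \<comment> \<open>Writing the cardinalities as \<open>Suc k\<close> and \<open>Suc k + d\<close>
    makes the truncated subtractions in the exponents exact.\<close>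
  then obtain k where k: "card (block_record_lows (us @ vs)) = Suc k"
    using gr0_conv_Suc by blast
  obtain d where d: "card (set (us @ vs)) = Suc k + d"
    using le k by (metis le_Suc_ex)
  show ?thesis
  proof (cases "us = []")
    case True
    then have "N \<notin> block_record_lows vs"
      using notin block_record_lows_subset by fastforce
    with True k c show ?thesis
      unfolding block_weight_def block_record_lows_insert_max[OF assms(1)]
      by (simp add: mult_ac)
  next
    case False
    with k c d show ?thesis
      unfolding block_weight_def block_record_lows_insert_max[OF assms(1)]
      by (simp add: mult_ac)
  qed
qed

section \<open>Distributions with separated small elements\<close>

text \<open>Indexed by the actual numbers of elements and blocks, without the shift by
  \<open>r\<close>, so that inserting one element simply raises these indices.\<close>

definition separated_distributions :: "nat \<Rightarrow> nat \<Rightarrow> nat \<Rightarrow> nat list set set" where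
  "separated_distributions r M l =
     {L. lah_distribution M l L \<and>
         (\<forall>B\<in>L. \<forall>i\<in>{1..r}. \<forall>j\<in>{1..r}. i \<in> set B \<and> j \<in> set B \<longrightarrow> i = j)}"

lemma separated_distributionsD:
  assumes "L \<in> separated_distributions r M l"
  shows "lah_distribution M l L"
    and "\<lbrakk>B \<in> L; i \<in> {1..r}; j \<in> {1..r}; i \<in> set B; j \<in> set B\<rbrakk> \<Longrightarrow> i = j"
  using assms unfolding separated_distributions_def by blast+

lemma separated_distributionsI:
  assumes "lah_distribution M l L"
    and "\<And>B i j. \<lbrakk>B \<in> L; i \<in> {1..r}; j \<in> {1..r}; i \<in> set B; j \<in> set B\<rbrakk> \<Longrightarrow> i = j"
  shows "L \<in> separated_distributions r M l"
  using assms unfolding separated_distributions_def by blast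

lemma r_lah_distributions_eq:
  "r_lah_distributions r n k = separated_distributions r (n + r) (k + r)"
  by (simp add: r_lah_distributions_def separated_distributions_def)

text \<open>Disjointness of the underlying sets together with injectivity of \<open>set\<close>
  amounts to disjointness of any two different lists, because no list is empty.\<close>

lemma lah_distribution_iff:
  "lah_distribution m l L \<longleftrightarrow>
     (\<Union>B\<in>L. set B) = {1..m} \<and> [] \<notin> L \<and> (\<forall>B\<in>L. distinct B) \<and>
     (\<forall>B\<in>L. \<forall>C\<in>L. B \<noteq> C \<longrightarrow> set B \<inter> set C = {}) \<and> card L = l"
proof -
  have "disjoint (set ` L) \<and> inj_on set L \<longleftrightarrow>
      (\<forall>B\<in>L. \<forall>C\<in>L. B \<noteq> C \<longrightarrow> set B \<inter> set C = {})" if "[] \<notin> L"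
  proof
    assume "disjoint (set ` L) \<and> inj_on set L"
    then show "\<forall>B\<in>L. \<forall>C\<in>L. B \<noteq> C \<longrightarrow> set B \<inter> set C = {}"
      by (metis disjointD imageI inj_on_contraD)
  next
    assume *: "\<forall>B\<in>L. \<forall>C\<in>L. B \<noteq> C \<longrightarrow> set B \<inter> set C = {}"
    have "inj_on set L"
      by (rule inj_onI) (metis * Int_absorb set_empty that)
    moreover have "disjoint (set ` L)"
      by (intro disjointI; elim imageE) (metis *)
    ultimately show "disjoint (set ` L) \<and> inj_on set L" by simp
  qed
  then show ?thesis
    by (auto simp: lah_distribution_def partition_on_def)
qed

lemma lah_distribution_finite:
  assumes "lah_distribution m l L"
  shows "finite L"
proof -
  have "finite (set ` L)"
    using assms by (auto simp: lah_distribution_def partition_on_def intro: finite_UnionD)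
  then show ?thesis
    using assms by (auto simp: lah_distribution_def dest: finite_imageD)
qed

text \<open>For \<open>r = 0\<close> the separation condition is vacuous, so that case contains all
  others.\<close>

lemma finite_separated_distributions: "finite (separated_distributions r M l)"
proof -
  have "separated_distributions r M l \<subseteq> r_lah_distributions 0 M l"
    unfolding separated_distributions_def r_lah_distributions_def by auto
  then show ?thesis
    by (rule finite_subset) (rule finite_r_lah_distributions)
qed

text \<open>The first \<open>r\<close> elements need \<open>r\<close> different blocks, and the
  heads of the blocks are different elements. These bounds make the boundary terms of the recurrence
  vanish.\<close>

lemma separated_distributions_bounds:
  assumes L: "L \<in> separated_distributions r M l" and "r \<le> M"
  shows "r \<le> l" and "l \<le> M"
proof -
  have lah: "lah_distribution M l L"
    and sep: "\<And>B i j. \<lbrakk>B \<in> L; i \<in> {1..r}; j \<in> {1..r}; i \<in> set B; j \<in> set B\<rbrakk> \<Longrightarrow> i = j"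
    using separated_distributionsD[OF L] by blast+
  note lah' = lah[unfolded lah_distribution_iff]
  have fin: "finite L"
    using lah by (rule lah_distribution_finite)
  have "\<exists>B\<in>L. i \<in> set B" if "i \<in> {1..r}" for i
    using lah' that \<open>r \<le> M\<close> by (metis UN_iff atLeastAtMost_iff le_trans)
  then have "card {1..r} \<le> card L"
    using sep by (intro card_le_if_inj_on_rel[OF fin, where r = "\<lambda>i B. i \<in> set B"]) metis+
  then show "r \<le> l"
    using lah' by simp
  have hd: "hd B \<in> set B" if "B \<in> L" for B
    using that lah' by (metis hd_in_set)
  have "inj_on hd L"
    by (rule inj_onI) (metis hd lah' disjoint_iff)
  moreover have "hd ` L \<subseteq> {1..M}"
    using hd lah' by blast
  ultimately have "card L \<le> card {1..M}"
    by (rule card_inj_on_le) simp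
  then show "l \<le> M"
    using lah' by simp
qed

text \<open>Blocks are disjoint, so both statistics are sums over the blocks and the weight becomes
  a product.\<close>

lemma distribution_weight:
  fixes a b :: "'a::comm_semiring_1"
  assumes "lah_distribution m l L"
  shows "a ^ nrec L * b ^ rec_star L = (\<Prod>B\<in>L. block_weight a b B)"
proof -
  note lah = assms[unfolded lah_distribution_iff]
  have fin: "finite L"
    using assms by (rule lah_distribution_finite)
  have disj: "\<And>B C. \<lbrakk>B \<in> L; C \<in> L; B \<noteq> C\<rbrakk> \<Longrightarrow> set B \<inter> set C = {}"
    using lah by blast
  note low = block_record_lows_subset[THEN subsetD]
  \<comment> \<open>An element of \<open>B\<close> cannot be a record low of another block, so the
    difference may be taken block by block.\<close>
  have "(\<Union>B\<in>L. set B) - (\<Union>B\<in>L. block_record_lows B) =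
      (\<Union>B\<in>L. set B - block_record_lows B)"
    using disj low by (blast dest: equalityD1)
  then have "nrec L = card (\<Union>B\<in>L. set B - block_record_lows B)"
    by (simp add: nrec_def)
  also have "\<dots> = (\<Sum>B\<in>L. card (set B - block_record_lows B))"
    using disj fin by (intro card_UN_disjoint) blast+
  also have "\<dots> = (\<Sum>B\<in>L. card (set B) - card (block_record_lows B))"
    by (simp add: block_record_lows_subset card_Diff_subset)
  finally have nrec: "nrec L = \<dots>" .
  have "rec_star L = card (\<Union>B\<in>L. block_record_lows B - {Min (set B)})"
    unfolding rec_star_def by (rule arg_cong[where f = card]) auto
  also have "\<dots> = (\<Sum>B\<in>L. card (block_record_lows B - {Min (set B)}))"
    using disj fin low by (intro card_UN_disjoint) (auto, blast)
  also have "\<dots> = (\<Sum>B\<in>L. card (block_record_lows B) - 1)"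
    by (rule sum.cong[OF refl]) (metis lah Min_mem_block_record_lows card_Diff_singleton)
  finally have "rec_star L = \<dots>" .
  with nrec show ?thesis
    by (simp add: power_sum prod.distrib block_weight_def)
qed

section \<open>Insertion of the largest element\<close>

text \<open>Position \<open>p = 0\<close> is the front of \<open>B\<close>; a positive
  \<open>p\<close> up to \<open>length B\<close> means directly after the \<open>p\<close>-th
  element. A block thus offers \<open>length B + 1\<close> places.\<close>

definition insert_in_block :: "nat \<Rightarrow> nat list set \<Rightarrow> nat list \<Rightarrow> nat \<Rightarrow> nat list set" where
  "insert_in_block N L B p = insert (take p B @ N # drop p B) (L - {B})"

text \<open>The case where the largest element is alone in its block; deleting that block is the
  inverse map.\<close>

lemma separated_distributions_insert_singleton:
  assumes "r \<le> M"
  shows "bij_betw (insert [Suc M]) (separated_distributions r M l)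
    {L \<in> separated_distributions r (Suc M) (Suc l). [Suc M] \<in> L}"
proof (rule bij_betw_byWitness[where f' = "\<lambda>L. L - {[Suc M]}"])
  have "[Suc M] \<notin> L" if "L \<in> separated_distributions r M l" for L
  proof -
    have "(\<Union>B\<in>L. set B) = {1..M}"
      using separated_distributionsD(1)[OF that] by (simp add: lah_distribution_iff)
    then show ?thesis
      by force
  qed
  then show "\<forall>L\<in>separated_distributions r M l. insert [Suc M] L - {[Suc M]} = L"
    by simp
  show "insert [Suc M] ` separated_distributions r M l \<subseteq>
      {L \<in> separated_distributions r (Suc M) (Suc l). [Suc M] \<in> L}"
  proof (rule image_subsetI)
    fix L
    assume L: "L \<in> separated_distributions r M l"
    then have lah: "lah_distribution M l L"
      by (rule separated_distributionsD)
    then have "(\<Union>B\<in>L. set B) = {1..M}"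
      by (simp add: lah_distribution_iff)
    then have new: "\<forall>B\<in>L. Suc M \<notin> set B"
      by force
    then have "[Suc M] \<notin> L"
      by force
    then have "card (insert [Suc M] L) = Suc l"
      using lah lah_distribution_finite[OF lah] by (simp add: lah_distribution_iff)
    then have "lah_distribution (Suc M) (Suc l) (insert [Suc M] L)"
      using lah new unfolding lah_distribution_iff by (simp add: atLeastAtMostSuc_conv)
    then show "insert [Suc M] L \<in>
        {L \<in> separated_distributions r (Suc M) (Suc l). [Suc M] \<in> L}"
      using assms separated_distributionsD(2)[OF L]
      by (auto intro!: separated_distributionsI)
  qed
  show "(\<lambda>L. L - {[Suc M]}) `
      {L \<in> separated_distributions r (Suc M) (Suc l). [Suc M] \<in> L} \<subseteq>
      separated_distributions r M l"
  proof (rule image_subsetI, clarify)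
    fix L
    assume L: "L \<in> separated_distributions r (Suc M) (Suc l)" and mem: "[Suc M] \<in> L"
    then have lah: "lah_distribution (Suc M) (Suc l) L"
      by (blast dest: separated_distributionsD(1))
    note lah' = lah[unfolded lah_distribution_iff]
    have "Suc M \<notin> set B" if "B \<in> L - {[Suc M]}" for B
    proof -
      have "set B \<inter> set [Suc M] = {}"
        using lah' that mem by blast
      then show ?thesis by simp
    qed
    moreover have "(\<Union>B\<in>L. set B) = insert (Suc M) (\<Union>B\<in>L - {[Suc M]}. set B)"
      using mem by force
    ultimately have "(\<Union>B\<in>L - {[Suc M]}. set B) = {1..Suc M} - {Suc M}"
      using lah' by auto
    then have "(\<Union>B\<in>L - {[Suc M]}. set B) = {1..M}"
      by auto
    moreover have "card (L - {[Suc M]}) = l"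
      using lah' mem lah_distribution_finite[OF lah] by simp
    ultimately have "lah_distribution M l (L - {[Suc M]})"
      using lah' unfolding lah_distribution_iff by blast
    then show "L - {[Suc M]} \<in> separated_distributions r M l"
      using separated_distributionsD(2)[OF L] by (blast intro: separated_distributionsI)
  qed
qed auto

text \<open>The case where the largest element joins an old block: a triple records the old
  distribution, the block and the place. As \<open>r \<le> M\<close>, the new element is not one of
  those to be separated, so every place is allowed.\<close>

lemma separated_distributions_insert_in_block:
  assumes "r \<le> M"
  shows "bij_betw (\<lambda>(L, B, p). insert_in_block (Suc M) L B p)
    (SIGMA L:separated_distributions r M l. SIGMA B:L. {..length B})
    {L \<in> separated_distributions r (Suc M) l. [Suc M] \<notin> L}"
proof (rule bij_betw_imageI)
  let ?S = "SIGMA L:separated_distributions r M l. SIGMA B:L. {..length B}"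
  let ?f = "\<lambda>(L, B, p). insert_in_block (Suc M) L B p"
  have new: "Suc M \<notin> set B" if "L \<in> separated_distributions r M l" "B \<in> L" for L B
  proof
    assume "Suc M \<in> set B"
    then have "Suc M \<in> (\<Union>B\<in>L. set B)"
      using that by blast
    also have "\<dots> = {1..M}"
      using separated_distributionsD(1)[OF that(1)] by (simp add: lah_distribution_iff)
    finally show False
      by simp
  qed
  show "inj_on ?f ?S"
  proof (rule inj_onI)
    fix t t'
    assume "t \<in> ?S" "t' \<in> ?S" "?f t = ?f t'"
    then obtain L B p L' B' p' where t: "t = (L, B, p)" "t' = (L', B', p')"
      and L: "L \<in> separated_distributions r M l" "B \<in> L" "p \<le> length B"
      and L': "L' \<in> separated_distributions r M l" "B' \<in> L'" "p' \<le> length B'"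
      and eq: "insert_in_block (Suc M) L B p = insert_in_block (Suc M) L' B' p'"
      by auto
    let ?C = "take p B @ Suc M # drop p B" and ?C' = "take p' B' @ Suc M # drop p' B'"
    \<comment> \<open>Only the inserted list contains \<open>Suc M\<close>, so the two inserted
      lists must agree.\<close>
    have "?C \<in> insert ?C' (L' - {B'})"
      using eq unfolding insert_in_block_def by blast
    moreover have notin: "?C \<notin> L'" "?C \<notin> L" "?C' \<notin> L'"
      using new[OF L(1), of ?C] new[OF L'(1), of ?C] new[OF L'(1), of ?C'] by auto
    ultimately have C: "?C = ?C'"
      by blast
    have N: "Suc M \<notin> set B" "Suc M \<notin> set B'"
      using new L L' by auto
    \<comment> \<open>\<open>Suc M\<close> occurs only once in the common list, so the splitting
      around it is unique.\<close>
    have td: "take p B = take p' B' \<and> drop p B = drop p' B'"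
      using C N
      by (subst (asm) append_Cons_eq_iff) (auto dest: in_set_takeD in_set_dropD)
    then have B: "B = B'"
      by (metis append_take_drop_id)
    have p: "p = p'"
      using td L(3) L'(3) by (metis length_take min.absorb2)
    have "L - {B} = L' - {B'}"
      using eq notin C unfolding insert_in_block_def by (metis Diff_iff insert_ident)
    then have "L = L'"
      using L(2) L'(2) B by blast
    with B p t show "t = t'"
      by simp
  qed
  show "?f ` ?S = {L \<in> separated_distributions r (Suc M) l. [Suc M] \<notin> L}"
  proof (intro equalityI subsetI)
    fix K
    assume "K \<in> ?f ` ?S"
    then obtain L B p where L: "L \<in> separated_distributions r M l" and B: "B \<in> L"
      and p: "p \<le> length B" and K: "K = insert_in_block (Suc M) L B p"
      by auto
    define C where "C = take p B @ Suc M # drop p B"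
    have lah: "lah_distribution M l L"
      using L by (rule separated_distributionsD)
    note lah' = lah[unfolded lah_distribution_iff]
    have K: "K = insert C (L - {B})"
      using K by (simp add: insert_in_block_def C_def)
    have setC: "set C = insert (Suc M) (set B)"
      unfolding C_def by (metis append_take_drop_id list.simps(15) set_append Un_insert_right)
    have "distinct (take p B @ drop p B)" "Suc M \<notin> set (take p B @ drop p B)"
      using lah' B new[OF L B] by simp_all
    then have distC: "distinct C"
      by (auto simp: C_def simp del: append_take_drop_id)
    have "C \<notin> L"
      using new[OF L, of C] setC by blast
    then have card: "card K = l"
      using lah' B lah_distribution_finite[OF lah] unfolding K
      by (simp add: card.insert_remove card_Diff_singleton)
        (metis Suc_pred card_gt_0_iff empty_iff)
    have "(\<Union>X\<in>K. set X) = insert (Suc M) (\<Union>X\<in>L. set X)"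
      unfolding K using setC B by auto
    then have union: "(\<Union>X\<in>K. set X) = {1..Suc M}"
      using lah' by auto
    have "set C \<inter> set X = {}" if "X \<in> L - {B}" for X
      using that lah' B new[OF L, of X] unfolding setC by (metis DiffD1 DiffD2 Int_insert_left singletonI)
    then have disj: "\<forall>X\<in>K. \<forall>Y\<in>K. X \<noteq> Y \<longrightarrow> set X \<inter> set Y = {}"
      using lah' unfolding K by blast
    have "[] \<notin> K"
      using lah' by (simp add: K C_def)
    moreover have "\<forall>X\<in>K. distinct X"
      using lah' distC unfolding K by blast
    ultimately have "lah_distribution (Suc M) l K"
      unfolding lah_distribution_iff by (intro conjI union disj card)
    moreover have "i = j"
      if "X \<in> K" "i \<in> {1..r}" "j \<in> {1..r}" "i \<in> set X" "j \<in> set X" for X i j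
    proof -
      have "i \<in> set B" if "i \<in> {1..r}" "i \<in> set C" for i
        using that assms setC by auto
      then show ?thesis
        using that separated_distributionsD(2)[OF L, of _ i j] B unfolding K by blast
    qed
    ultimately have "K \<in> separated_distributions r (Suc M) l"
      by (rule separated_distributionsI)
    moreover have "[Suc M] \<notin> K"
    proof -
      have "B \<noteq> []"
        using lah' B by blast
      moreover have "length C = Suc (length B)"
        by (simp add: C_def)
      ultimately have "C \<noteq> [Suc M]"
        by force
      then show ?thesis
        using new[OF L, of "[Suc M]"] unfolding K by auto
    qed
    ultimately show "K \<in> {L \<in> separated_distributions r (Suc M) l. [Suc M] \<notin> L}"
      by blast
  next
    fix K
    assume "K \<in> {L \<in> separated_distributions r (Suc M) l. [Suc M] \<notin> L}"
    then have K: "K \<in> separated_distributions r (Suc M) l" and nmem: "[Suc M] \<notin> K"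
      by auto
    then have lah: "lah_distribution (Suc M) l K"
      by (blast dest: separated_distributionsD(1))
    note lah' = lah[unfolded lah_distribution_iff]
    have "Suc M \<in> (\<Union>B\<in>K. set B)"
      using lah' by simp
    then obtain C where C: "C \<in> K" "Suc M \<in> set C"
      by blast
    then obtain us vs where uv: "C = us @ Suc M # vs"
      by (meson split_list)
    define B where "B = us @ vs"
    define L where "L = insert B (K - {C})"
    have "distinct C"
      using lah' C by blast
    then have N: "Suc M \<notin> set B" "distinct B"
      by (auto simp: uv B_def)
    have setC: "set C = insert (Suc M) (set B)"
      by (simp add: uv B_def)
    \<comment> \<open>Excluding \<open>[Suc M]\<close> from \<open>K\<close> guarantees that the
      block stays non-empty when \<open>Suc M\<close> is deleted.\<close>
    have "B \<noteq> []"
      using nmem C uv by (auto simp: B_def)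
    then obtain x where x: "x \<in> set B"
      by (metis last_in_set)
    have disj: "set C \<inter> set X = {}" if "X \<in> K - {C}" for X
      using that lah' C by blast
    \<comment> \<open>A list with the element \<open>x\<close> of \<open>C\<close> cannot be another
      block; so exchanging \<open>C\<close> for \<open>B\<close> keeps the number of blocks.\<close>
    have "B \<notin> K - {C}"
      using disj x setC by blast
    then have card: "card L = l"
      using lah' C lah_distribution_finite[OF lah] unfolding L_def
      by (simp add: card_Diff_singleton) (metis Suc_pred card_gt_0_iff empty_iff)
    have "Suc M \<notin> (\<Union>X\<in>L. set X)"
      using disj N setC unfolding L_def by blast
    moreover have "(\<Union>X\<in>K. set X) = insert (Suc M) (\<Union>X\<in>L. set X)"
      using setC C unfolding L_def by auto
    ultimately have "(\<Union>X\<in>L. set X) = {1..Suc M} - {Suc M}"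
      using lah' by auto
    then have union: "(\<Union>X\<in>L. set X) = {1..M}"
      by auto
    have "set B \<inter> set X = {}" if "X \<in> K - {C}" for X
      using disj[OF that] setC by blast
    then have disj': "\<forall>X\<in>L. \<forall>Y\<in>L. X \<noteq> Y \<longrightarrow> set X \<inter> set Y = {}"
      using lah' unfolding L_def by blast
    have "[] \<notin> L" "\<forall>X\<in>L. distinct X"
      using N \<open>B \<noteq> []\<close> lah' unfolding L_def by blast+
    then have "lah_distribution M l L"
      unfolding lah_distribution_iff by (intro conjI union disj' card)
    moreover have "i = j"
      if "X \<in> L" "i \<in> {1..r}" "j \<in> {1..r}" "i \<in> set X" "j \<in> set X" for X i j
      using that separated_distributionsD(2)[OF K, of _ i j] C(1) setC unfolding L_def by blast
    ultimately have "L \<in> separated_distributions r M l"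
      by (rule separated_distributionsI)
    moreover have "insert_in_block (Suc M) L B (length us) = K"
      using \<open>B \<notin> K - {C}\<close> C(1) by (auto simp: insert_in_block_def L_def B_def uv)
    moreover have "B \<in> L" "length us \<le> length B"
      by (auto simp: L_def B_def)
    ultimately show "K \<in> ?f ` ?S"
      by (intro image_eqI[where x = "(L, B, length us)"]) auto
  qed
qed

definition total_weight :: "'a::comm_semiring_1 \<Rightarrow> 'a \<Rightarrow> nat \<Rightarrow> nat \<Rightarrow> nat \<Rightarrow> 'a" where
  "total_weight a b r M l =
     (\<Sum>L\<in>separated_distributions r M l. \<Prod>B\<in>L. block_weight a b B)"

lemma total_weight_insert_singleton:
  assumes "r \<le> M"
  shows "(\<Sum>L\<in>{L \<in> separated_distributions r (Suc M) (Suc l). [Suc M] \<in> L}.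
      \<Prod>B\<in>L. block_weight a b B) = total_weight a b r M l"
  unfolding total_weight_def
    sum.reindex_bij_betw[OF separated_distributions_insert_singleton[OF assms], symmetric]
proof (rule sum.cong[OF refl])
  fix L
  assume "L \<in> separated_distributions r M l"
  then have lah: "lah_distribution M l L"
    by (rule separated_distributionsD)
  then have "(\<Union>B\<in>L. set B) = {1..M}"
    by (simp add: lah_distribution_iff)
  then have "[Suc M] \<notin> L"
    by force
  then show "(\<Prod>B\<in>insert [Suc M] L. block_weight a b B) = (\<Prod>B\<in>L. block_weight a b B)"
    using lah_distribution_finite[OF lah] by simp
qed

text \<open>Each of the \<open>l\<close> blocks has one front place of weight \<open>b\<close>. The
  places behind elements have weight \<open>a\<close>, and there are \<open>M\<close> of them in
  all. The resulting factor is therefore the same for every distribution.\<close>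

lemma total_weight_insert_in_block:
  fixes a b :: "'a::comm_semiring_1"
  assumes "r \<le> M"
  shows "(\<Sum>L\<in>{L \<in> separated_distributions r (Suc M) l. [Suc M] \<notin> L}.
      \<Prod>B\<in>L. block_weight a b B) = (a * of_nat M + b * of_nat l) * total_weight a b r M l"
proof -
  let ?W = "\<lambda>L. \<Prod>B\<in>L. block_weight a b B"
  have fin: "finite L" if "L \<in> separated_distributions r M l" for L
    using that by (intro lah_distribution_finite separated_distributionsD(1))
  have W: "?W (insert_in_block (Suc M) L B p) = (if p = 0 then b else a) * ?W L"
    if L: "L \<in> separated_distributions r M l" and B: "B \<in> L" and p: "p \<le> length B" for L B p
  proof -
    have lah: "lah_distribution M l L"
      using L by (rule separated_distributionsD)
    note lah' = lah[unfolded lah_distribution_iff]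
    have lt: "\<forall>x\<in>set X. x < Suc M" if "X \<in> L" for X
      using lah' that by (metis UN_I atLeastAtMost_iff less_Suc_eq_le)
    have ne: "B \<noteq> []"
      using lah' B by blast
    let ?C = "take p B @ Suc M # drop p B"
    have "?C \<notin> L"
      using lt[of ?C] by auto
    then have "?W (insert_in_block (Suc M) L B p) = block_weight a b ?C * ?W (L - {B})"
      using fin[OF L] by (simp add: insert_in_block_def)
    also have "block_weight a b ?C = (if p = 0 then b else a) * block_weight a b B"
      using block_weight_insert_max[of "take p B" "drop p B" "Suc M" a b] lt[OF B] ne by simp
    also have "\<dots> * ?W (L - {B}) = (if p = 0 then b else a) * ?W L"
      using prod.remove[OF fin[OF L] B, of "block_weight a b"] by (simp add: mult.assoc)
    finally show ?thesis .
  qed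
  have count: "(\<Sum>B\<in>L. \<Sum>p\<le>length B. if p = 0 then b else a) = a * of_nat M + b * of_nat l"
    if L: "L \<in> separated_distributions r M l" for L
  proof -
    have lah: "lah_distribution M l L"
      using L by (rule separated_distributionsD)
    note lah' = lah[unfolded lah_distribution_iff]
    have "(\<Sum>B\<in>L. length B) = (\<Sum>B\<in>L. card (set B))"
      by (rule sum.cong) (use lah' in \<open>auto simp: distinct_card\<close>)
    also have "\<dots> = card (\<Union>B\<in>L. set B)"
      by (rule card_UN_disjoint[symmetric]) (use lah' fin[OF L] in auto)
    also have "\<dots> = M"
      using lah' by simp
    finally have len: "(\<Sum>B\<in>L. length B) = M" .
    have "(\<Sum>p\<le>k. if p = 0 then b else a) = b + of_nat k * a" for k :: nat
      by (induction k) (simp_all add: algebra_simps)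
    then have "(\<Sum>B\<in>L. \<Sum>p\<le>length B. if p = 0 then b else a) =
        (\<Sum>B\<in>L. b + of_nat (length B) * a)"
      by simp
    also have "\<dots> = of_nat (card L) * b + of_nat (\<Sum>B\<in>L. length B) * a"
      by (simp add: sum.distrib sum_distrib_right)
    finally show ?thesis
      using len lah' by (simp add: algebra_simps)
  qed
  have "(\<Sum>L\<in>{L \<in> separated_distributions r (Suc M) l. [Suc M] \<notin> L}. ?W L) =
      (\<Sum>(L, B, p)\<in>(SIGMA L:separated_distributions r M l. SIGMA B:L. {..length B}).
         ?W (insert_in_block (Suc M) L B p))"
    unfolding sum.reindex_bij_betw[OF separated_distributions_insert_in_block[OF assms], symmetric]
    by (simp add: case_prod_unfold)
  also have "\<dots> = (\<Sum>L\<in>separated_distributions r M l. \<Sum>B\<in>L. \<Sum>p\<le>length B.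
      ?W (insert_in_block (Suc M) L B p))"
    using fin finite_separated_distributions by (simp add: sum.Sigma)
  also have "\<dots> = (\<Sum>L\<in>separated_distributions r M l. \<Sum>B\<in>L. \<Sum>p\<le>length B.
      (if p = 0 then b else a) * ?W L)"
    using W by (intro sum.cong refl) auto
  also have "\<dots> = (\<Sum>L\<in>separated_distributions r M l. (a * of_nat M + b * of_nat l) * ?W L)"
    using count by (intro sum.cong refl) (simp add: sum_distrib_right[symmetric])
  finally show ?thesis
    by (simp add: total_weight_def sum_distrib_left)
qed

text \<open>Split by whether \<open>Suc M\<close> forms a block alone. The guard at
  \<open>l = 0\<close> is needed because \<open>l - 1\<close> would be \<open>0\<close>
  again.\<close>

lemma total_weight_Suc:
  fixes a b :: "'a::comm_semiring_1"
  assumes "r \<le> M"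
  shows "total_weight a b r (Suc M) l =
    (if l = 0 then 0 else total_weight a b r M (l - 1)) +
    (a * of_nat M + b * of_nat l) * total_weight a b r M l"
proof -
  let ?S = "separated_distributions r (Suc M) l"
  let ?W = "\<lambda>L. \<Prod>B\<in>L. block_weight a b B"
  have "?S = {L \<in> ?S. [Suc M] \<in> L} \<union> {L \<in> ?S. [Suc M] \<notin> L}"
    by blast
  then have "total_weight a b r (Suc M) l =
      sum ?W ({L \<in> ?S. [Suc M] \<in> L} \<union> {L \<in> ?S. [Suc M] \<notin> L})"
    unfolding total_weight_def by simp
  also have "\<dots> = sum ?W {L \<in> ?S. [Suc M] \<in> L} + sum ?W {L \<in> ?S. [Suc M] \<notin> L}"
    by (rule sum.union_disjoint) (auto simp: finite_separated_distributions)
  also have "sum ?W {L \<in> ?S. [Suc M] \<in> L} = (if l = 0 then 0 else total_weight a b r M (l - 1))"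
  proof (cases l)
    case 0
    have "L = {}" if "L \<in> ?S" for L
    proof -
      have "lah_distribution (Suc M) 0 L"
        using that 0 separated_distributionsD(1) by blast
      then show ?thesis
        using lah_distribution_finite lah_distribution_iff card_0_eq by metis
    qed
    then have "{L \<in> ?S. [Suc M] \<in> L} = {}"
      by blast
    then have "sum ?W {L \<in> ?S. [Suc M] \<in> L} = 0"
      by (simp only: sum.empty)
    with 0 show ?thesis by simp
  next
    case (Suc k)
    then show ?thesis
      using total_weight_insert_singleton[OF assms, where l = k and a = a and b = b] by simp
  qed
  finally show ?thesis
    by (simp only: total_weight_insert_in_block[OF assms])
qed

section \<open>Recurrence for the generalized Lah numbers\<close>

text \<open>For \<open>k > n\<close> there would be more blocks than elements, so the sum is empty
  and agrees with the default value \<open>0\<close>.\<close>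

lemma gen_r_lah_eq_total_weight: "gen_r_lah a b n k r = total_weight a b r (n + r) (k + r)"
proof -
  have "separated_distributions r (n + r) (k + r) = {}" if "\<not> k \<le> n"
    using separated_distributions_bounds(2)[of _ r "n + r" "k + r"] that by fastforce
  moreover have "(\<Sum>L\<in>separated_distributions r (n + r) (k + r). a ^ nrec L * b ^ rec_star L) =
      total_weight a b r (n + r) (k + r)"
    unfolding total_weight_def
    by (intro sum.cong refl distribution_weight separated_distributionsD(1))
  ultimately show ?thesis
    by (auto simp: gen_r_lah_def r_lah_distributions_eq total_weight_def)
qed

lemma gen_r_lah_gt: "n < k \<Longrightarrow> gen_r_lah a b n k r = 0"
  by (simp add: gen_r_lah_def)

text \<open>All elements are separated from each other, so the only distribution consists of
  singletons, each of weight \<open>1\<close>.\<close>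

lemma gen_r_lah_0_0: "gen_r_lah a b 0 0 r = 1"
proof -
  have "separated_distributions r r r = {(\<lambda>i. [i]) ` {1..r}}"
  proof (intro equalityI subsetI)
    fix L
    assume L: "L \<in> separated_distributions r r r"
    then have lah: "(\<Union>B\<in>L. set B) = {1..r}" "[] \<notin> L" "\<forall>B\<in>L. distinct B"
      using separated_distributionsD(1)[OF L] unfolding lah_distribution_iff by blast+
    have single: "B = [i]" if B: "B \<in> L" and i: "i \<in> set B" for B i
    proof -
      have "\<forall>j\<in>set B. j = i"
        using separated_distributionsD(2)[OF L B] B i lah(1) by blast
      then have "set B = {i}"
        using i by blast
      moreover have "distinct B"
        using lah(3) B by blast
      ultimately show ?thesis
        by (metis distinct_singleton empty_set list.simps(15) set_eq_iff distinct_card card_1_singleton_iff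
            length_0_conv length_Suc_conv list.set_intros(1) singletonD One_nat_def)
    qed
    have "L = (\<lambda>i. [i]) ` {1..r}"
    proof (intro equalityI subsetI)
      fix B
      assume "B \<in> L"
      then show "B \<in> (\<lambda>i. [i]) ` {1..r}"
        using single[of B] lah by (metis UN_I image_eqI last_in_set)
    next
      fix B
      assume "B \<in> (\<lambda>i. [i]) ` {1..r}"
      then obtain i where "B = [i]" "i \<in> {1..r}"
        by blast
      then show "B \<in> L"
        using single lah(1) by (metis UN_iff)
    qed
    then show "L \<in> {(\<lambda>i. [i]) ` {1..r}}"
      by simp
  next
    fix L
    assume "L \<in> {(\<lambda>i. [i]) ` {1..r}}"
    then have L: "L = (\<lambda>i. [i]) ` {1..r}"
      by simp
    have "lah_distribution r r L"
      unfolding L lah_distribution_iff by (auto simp: card_image inj_on_def)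
    then show "L \<in> separated_distributions r r r"
      by (rule separated_distributionsI) (auto simp: L)
  qed
  then show ?thesis
    by (simp add: gen_r_lah_eq_total_weight total_weight_def prod.reindex inj_on_def)
qed

lemma gen_r_lah_Suc:
  fixes a b :: "'a::comm_semiring_1"
  shows "gen_r_lah a b (Suc n) k r =
    (case k of 0 \<Rightarrow> 0 | Suc k' \<Rightarrow> gen_r_lah a b n k' r) +
    (a * of_nat (n + r) + b * of_nat (k + r)) * gen_r_lah a b n k r"
proof -
  \<comment> \<open>For \<open>k = 0\<close> the new-block term would refer to \<open>r - 1\<close>
    blocks, too few to separate \<open>r\<close> elements.\<close>
  have "total_weight a b r (n + r) (r - 1) = 0" if "r \<noteq> 0"
  proof -
    have "separated_distributions r (n + r) (r - 1) = {}"
      using separated_distributions_bounds(1)[of _ r "n + r" "r - 1"] that by fastforce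
    then show ?thesis
      by (simp add: total_weight_def)
  qed
  then show ?thesis
    using total_weight_Suc[of r "n + r" a b "k + r"]
    by (cases k) (auto simp: gen_r_lah_eq_total_weight)
qed

section \<open>Weighted extensions\<close>

text \<open>The first summand opens a new block, which adds an element and a block; the second joins
  an old block and adds only an element.\<close>

fun extension_weight :: "'a::comm_semiring_1 \<Rightarrow> 'a \<Rightarrow> nat \<Rightarrow> 'a \<Rightarrow> 'a" where
  "extension_weight a b 0 x = 1"
| "extension_weight a b (Suc n) x =
     extension_weight a b n (x + a + b) + x * extension_weight a b n (x + a)"

text \<open>Distribute the first \<open>m + r\<close> elements, then insert the other
  \<open>n\<close>. In the induction step the first of these is counted among the earlier ones,
  which is why \<open>m\<close> is arbitrary.\<close>

lemma gen_r_lah_row_add: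
  "gen_r_lah_row a b (n + m) r =
    (\<Sum>j=0..m. gen_r_lah a b m j r *
       extension_weight a b n (a * of_nat (m + r) + b * of_nat (j + r)))"
proof (induction n arbitrary: m)
  case 0
  show ?case by (simp add: gen_r_lah_row_def)
next
  case (Suc n)
  let ?x = "\<lambda>j. a * of_nat (m + r) + b * of_nat (j + r)"
  let ?y = "\<lambda>j. a * of_nat (Suc m + r) + b * of_nat (j + r)"
  let ?E = "\<lambda>j. extension_weight a b n (?y j)"
  have "gen_r_lah_row a b (Suc n + m) r = gen_r_lah_row a b (n + Suc m) r"
    by simp
  also have "\<dots> = (\<Sum>j=0..Suc m. gen_r_lah a b (Suc m) j r * ?E j)"
    by (rule Suc.IH)
  also have "\<dots> = (\<Sum>j=0..Suc m. (case j of 0 \<Rightarrow> 0 | Suc k \<Rightarrow> gen_r_lah a b m k r) * ?E j) +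
      (\<Sum>j=0..Suc m. ?x j * gen_r_lah a b m j r * ?E j)"
    by (simp only: gen_r_lah_Suc distrib_right sum.distrib)
  also have "(\<Sum>j=0..Suc m. (case j of 0 \<Rightarrow> 0 | Suc k \<Rightarrow> gen_r_lah a b m k r) * ?E j) =
      (\<Sum>j=0..m. gen_r_lah a b m j r * ?E (Suc j))"
    by (subst sum.atLeast0_atMost_Suc_shift) (simp add: add_ac)
  \<comment> \<open>The top term vanishes, as \<open>m\<close> is less than
    \<open>Suc m\<close>.\<close>
  also have "(\<Sum>j=0..Suc m. ?x j * gen_r_lah a b m j r * ?E j) =
      (\<Sum>j=0..m. ?x j * gen_r_lah a b m j r * ?E j)"
    by (simp add: gen_r_lah_gt)
  \<comment> \<open>\<open>?y (Suc j)\<close> equals \<open>?x j + a + b\<close> and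
    \<open>?y j\<close> equals \<open>?x j + a\<close>: the two arguments in the recursion of
    \<open>extension_weight\<close>.\<close>
  also have "(\<Sum>j=0..m. gen_r_lah a b m j r * ?E (Suc j)) +
        (\<Sum>j=0..m. ?x j * gen_r_lah a b m j r * ?E j) =
      (\<Sum>j=0..m. gen_r_lah a b m j r * extension_weight a b (Suc n) (?x j))"
    unfolding sum.distrib[symmetric] by (intro sum.cong refl) (simp add: algebra_simps)
  finally show ?case .
qed

lemma gen_r_lah_row_0: "gen_r_lah_row a b n 0 = extension_weight a b n 0"
  using gen_r_lah_row_add[of a b n 0 0] by (simp add: gen_r_lah_0_0)

text \<open>Pascal's rule for a binomial convolution: each term of the shorter sum splits according
  to which argument of \<open>f\<close> is raised.\<close>

lemma sum_choose_Suc: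
  fixes f :: "nat \<Rightarrow> nat \<Rightarrow> 'a::comm_semiring_1"
  shows "(\<Sum>i=0..Suc n. of_nat (Suc n choose i) * f i (Suc n - i)) =
    (\<Sum>i=0..n. of_nat (n choose i) * (f (Suc i) (n - i) + f i (Suc (n - i))))"
proof -
  have "(\<Sum>i=0..Suc n. of_nat (Suc n choose i) * f i (Suc n - i)) =
      f 0 (Suc n) + (\<Sum>i=0..n. of_nat (n choose Suc i) * f (Suc i) (n - i)) +
      (\<Sum>i=0..n. of_nat (n choose i) * f (Suc i) (n - i))"
    by (subst sum.atLeast0_atMost_Suc_shift) (simp add: distrib_right sum.distrib add_ac)
  also have "f 0 (Suc n) + (\<Sum>i=0..n. of_nat (n choose Suc i) * f (Suc i) (n - i)) =
      (\<Sum>i=0..Suc n. of_nat (n choose i) * f i (Suc n - i))"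
    by (subst sum.atLeast0_atMost_Suc_shift) simp
  also have "\<dots> = (\<Sum>i=0..n. of_nat (n choose i) * f i (Suc (n - i)))"
    by (simp add: Suc_diff_le binomial_eq_0)
  finally show ?thesis
    by (simp add: distrib_left sum.distrib add_ac)
qed

text \<open>By Pascal's rule, either \<open>extension_weight\<close> unfolds or the product gives up
  its factor \<open>y\<close> and shifts to \<open>y + a\<close>. The induction hypothesis applies
  at \<open>(x + a + b, y)\<close>, \<open>(x + a, y)\<close> and \<open>(x, y + a)\<close>; the
  last two pairs have equal sums, so \<open>x\<close> and \<open>y\<close> combine into the factor
  \<open>x + y\<close>.\<close>

lemma extension_weight_add:
  fixes a b x y :: "'a::comm_semiring_1"
  shows "extension_weight a b n (x + y) =
    (\<Sum>i=0..n. of_nat (n choose i) * (extension_weight a b i x * (\<Prod>l<n - i. a * of_nat l + y)))"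
proof (induction n arbitrary: x y)
  case 0
  show ?case by simp
next
  case (Suc n)
  let ?E = "extension_weight a b"
  let ?P = "\<lambda>y k. \<Prod>l<k. a * of_nat l + y"
  have P: "?P y (Suc k) = y * ?P (y + a) k" for k
    by (subst prod.lessThan_Suc_shift) (simp add: algebra_simps)
  have "(\<Sum>i=0..Suc n. of_nat (Suc n choose i) * (?E i x * ?P y (Suc n - i))) =
      (\<Sum>i=0..n. of_nat (n choose i) * (?E (Suc i) x * ?P y (n - i) + ?E i x * ?P y (Suc (n - i))))"
    by (rule sum_choose_Suc)
  also have "\<dots> = (\<Sum>i=0..n. of_nat (n choose i) * (?E i (x + a + b) * ?P y (n - i))) +
      x * (\<Sum>i=0..n. of_nat (n choose i) * (?E i (x + a) * ?P y (n - i))) +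
      y * (\<Sum>i=0..n. of_nat (n choose i) * (?E i x * ?P (y + a) (n - i)))"
    unfolding P extension_weight.simps sum_distrib_left sum.distrib[symmetric]
    by (intro sum.cong refl) (simp add: algebra_simps)
  also have "\<dots> = ?E n (x + a + b + y) + x * ?E n (x + a + y) + y * ?E n (x + (y + a))"
    by (simp only: Suc.IH)
  also have "\<dots> = ?E (Suc n) (x + y)"
    by (simp add: algebra_simps)
  finally show ?case ..
qed

theorem mainTheorem4:
  fixes a b :: "'a::comm_ring_1" and r n m :: nat
  shows "gen_r_lah_row a b (n + m) r =
    (\<Sum>i=0..n. \<Sum>j=0..m. of_nat (n choose i) * gen_r_lah a b m j r * gen_r_lah_row a b i 0 *
       (\<Prod>l\<in>{..<n - i}. a * of_nat l + a * of_nat (m + r) + b * of_nat (j + r)))"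
proof -
  \<comment> \<open>The addition formula with \<open>x = 0\<close> chooses the \<open>i\<close> new
    elements that form blocks of their own, weighted as a row sum for \<open>r = 0\<close>; the
    product inserts the remaining \<open>n - i\<close> into the old blocks.\<close>
  have "gen_r_lah_row a b (n + m) r =
      (\<Sum>j=0..m. \<Sum>i=0..n. gen_r_lah a b m j r * (of_nat (n choose i) * (extension_weight a b i 0 *
         (\<Prod>l<n - i. a * of_nat l + (a * of_nat (m + r) + b * of_nat (j + r))))))"
    unfolding gen_r_lah_row_add sum_distrib_left[symmetric] extension_weight_add[symmetric] by simp
  also have "\<dots> = (\<Sum>i=0..n. \<Sum>j=0..m. gen_r_lah a b m j r * (of_nat (n choose i) *
      (extension_weight a b i 0 *
         (\<Prod>l<n - i. a * of_nat l + (a * of_nat (m + r) + b * of_nat (j + r))))))"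
    by (rule sum.swap)
  finally show ?thesis
    by (simp add: gen_r_lah_row_0 mult_ac add.assoc)
qed

end
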